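(* Let $B_\alpha\in\{0,1\}^{\mathbb{Z}}$ be the Beatty sequence of a real number $\alpha\in[0,1]$. Then: (i) the recurrence function $\tilde{M}_{B_\alpha}(T)$ is bounded if and only if $\alpha$ is rational; (ii) the recurrence function satisfies $\tilde{M}_{B_\alpha}(T)=O(T)$ as $T\to\infty$ if and only if $\alpha$ is badly approximable, i.e. $\alpha$ is a number whose regular continued fraction expansion has bounded partial quotients.
   Context: The Beatty sequence $B_\alpha=\{b_k\}_{k\in\mathbb{Z}}$ of $\alpha\in[0,1]$ is given by $b_k=\lfloor(k+1)\alpha\rfloor-\lfloor k\alpha\rfloor$. For a bi-infinite sequence $B\in\{0,1\}^{\mathbb{Z}}$ the recurrence function $\tilde{M}_B(\ell)$, $\ell=1,2,\ldots$, is the maximum difference in index between the leftmost symbols of two consecutive occurrences in $B$ of any word $w\in\{0,1\}^\ell$ of length $\ell$ that occurs at least once in $B$ (with $\tilde{M}_B(\ell)=+\infty$ if some word of length $\ell$ occurs exactly once in $B$). The variable $T$ in the claim ranges over positive integers. Having bounded partial quotients is taken as the definition of badly approximable here; a rational number has a finite continued fraction expansion and so satisfies this condition. *)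

theory Defs
  imports "HOL-Analysis.Analysis"
begin

definition beatty :: "real \<Rightarrow> int \<Rightarrow> int" where
  "beatty \<alpha> k = \<lfloor>of_int (k + 1) * \<alpha>\<rfloor> - \<lfloor>of_int k * \<alpha>\<rfloor>"

lemma beatty_in_01:
  assumes "\<alpha> \<in> {0..1}"
  shows "beatty \<alpha> k \<in> {0, 1}"
proof -
  have "of_int (k + 1) * \<alpha> = of_int k * \<alpha> + \<alpha>"
    by (simp add: algebra_simps)
  moreover have "0 \<le> \<alpha>" "\<alpha> \<le> 1"
    using assms by auto
  ultimately have "\<lfloor>of_int k * \<alpha>\<rfloor> \<le> \<lfloor>of_int (k + 1) * \<alpha>\<rfloor>"
    "\<lfloor>of_int (k + 1) * \<alpha>\<rfloor> \<le> \<lfloor>of_int k * \<alpha>\<rfloor> + 1"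
    by linarith+
  then show ?thesis
    unfolding beatty_def by auto
qed

text \<open>Bi-infinite sequences are functions on the integers and words are lists; the position of an
  occurrence is the index of its leftmost symbol.\<close>

definition occurs_at :: "(int \<Rightarrow> int) \<Rightarrow> int list \<Rightarrow> int \<Rightarrow> bool" where
  "occurs_at B w i \<longleftrightarrow> (\<forall>m < length w. B (i + int m) = w ! m)"

definition consecutive_occurrences :: "(int \<Rightarrow> int) \<Rightarrow> int list \<Rightarrow> int \<Rightarrow> int \<Rightarrow> bool" where
  "consecutive_occurrences B w i j \<longleftrightarrow>
     i < j \<and> occurs_at B w i \<and> occurs_at B w j \<and> (\<forall>k. i < k \<and> k < j \<longrightarrow> \<not> occurs_at B w k)"

text \<open>The maximum is a supremum in the extended naturals, hence also \<open>\<infinity>\<close> when the differences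
  between consecutive occurrences are unbounded. The value at \<open>\<infinity>\<close> for a word that occurs exactly
  once has to be stipulated, because such a word contributes no pair of consecutive occurrences.\<close>

definition recurrence_function :: "(int \<Rightarrow> int) \<Rightarrow> nat \<Rightarrow> enat" where
  "recurrence_function B l =
     (if \<exists>w. set w \<subseteq> {0, 1} \<and> length w = l \<and> (\<exists>!i. occurs_at B w i) then \<infinity>
      else Sup {enat (nat (j - i)) | w i j.
                  set w \<subseteq> {0, 1} \<and> length w = l \<and> consecutive_occurrences B w i j})"

text \<open>The regular continued fraction expansion is generated by the complete quotients: the step is
  \<open>y \<mapsto> 1 / frac y\<close>, and the expansion stops (value \<open>None\<close>) after an integral complete quotient,
  which happens exactly for rational numbers.\<close>

primrec complete_quotient :: "real \<Rightarrow> nat \<Rightarrow> real option" where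
  "complete_quotient x 0 = Some x"
| "complete_quotient x (Suc n) =
     (case complete_quotient x n of
        None \<Rightarrow> None
      | Some y \<Rightarrow> if frac y = 0 then None else Some (1 / frac y))"

definition partial_quotient :: "real \<Rightarrow> nat \<Rightarrow> int option" where
  "partial_quotient x n = map_option floor (complete_quotient x n)"

text \<open>Finite expansions qualify, so rational numbers count as badly approximable.\<close>

definition badly_approximable :: "real \<Rightarrow> bool" where
  "badly_approximable x \<longleftrightarrow> (\<exists>C. \<forall>n a. partial_quotient x n = Some a \<longrightarrow> \<bar>a\<bar> \<le> C)"

end

theory Submission
  imports Defs
begin

text \<open>Write \<open>\<parallel>x\<parallel>\<close> for the distance from \<open>x\<close> to the nearest integer and \<open>q\<^sub>n\<close> for the denominators
  of the convergents of an irrational \<open>\<alpha>\<close>. The word of length \<open>q\<close> at position \<open>0\<close> or \<open>-q\<close> occurs only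
  at indices \<open>j\<close> for which \<open>j\<alpha>\<close> lies, modulo 1, in a fixed half-open arc of length \<open>\<parallel>q\<alpha>\<parallel>\<close>. Two such
  indices differ by some \<open>d\<close> with \<open>\<parallel>d\<alpha>\<parallel> < \<parallel>q\<alpha>\<parallel>\<close>, and for \<open>q = q\<^sub>n\<close> the best approximation property
  gives \<open>d \<ge> q\<^sub>n\<^sub>+\<^sub>1\<close>. Conversely, if \<open>q\<^sub>n \<le> T < q\<^sub>n\<^sub>+\<^sub>1\<close>, the words of length \<open>T\<close> correspond to arcs of
  length at least \<open>\<parallel>q\<^sub>n\<alpha>\<parallel> \<ge> \<parallel>q\<^sub>n\<^sub>+\<^sub>1\<alpha>\<parallel> + \<parallel>q\<^sub>n\<^sub>+\<^sub>2\<alpha>\<parallel>\<close>; since the rotations by \<open>q\<^sub>n\<^sub>+\<^sub>1\<alpha>\<close> and \<open>q\<^sub>n\<^sub>+\<^sub>2\<alpha>\<close>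
  go in opposite directions, one of them returns to the arc. Hence the recurrence function at \<open>q\<^sub>n\<close>
  is at least \<open>q\<^sub>n\<^sub>+\<^sub>1\<close>, and on \<open>[q\<^sub>n, q\<^sub>n\<^sub>+\<^sub>1)\<close> it is at most \<open>q\<^sub>n\<^sub>+\<^sub>2\<close>.\<close>

section \<open>Recurrence of words\<close>

text \<open>A repetition within \<open>N\<close> of every window rules out words that occur only
  once and, for any other word, caps the distance to the next occurrence.\<close>

lemma recurrence_function_le:
  assumes "\<And>i. \<exists>j>i. j \<le> i + int N \<and> (\<forall>m<T. B (j + int m) = B (i + int m))"
  shows "recurrence_function B T \<le> enat N"
proof -
  have next_occ: "\<exists>j>i. j \<le> i + int N \<and> occurs_at B w j" if "length w = T" "occurs_at B w i" for w i
    using assms[of i] that unfolding occurs_at_def by metis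
  have "\<not> (\<exists>w. set w \<subseteq> {0, 1} \<and> length w = T \<and> (\<exists>!i. occurs_at B w i))"
    using next_occ by (metis less_irrefl)
  moreover have "j - i \<le> int N" if w: "length w = T" "consecutive_occurrences B w i j" for w i j
  proof -
    obtain k where "k > i" "k \<le> i + int N" "occurs_at B w k"
      using next_occ w unfolding consecutive_occurrences_def by blast
    then have "j \<le> k"
      using w unfolding consecutive_occurrences_def by (meson not_le)
    with \<open>k \<le> i + int N\<close> show ?thesis by simp
  qed
  ultimately show ?thesis
    unfolding recurrence_function_def by (auto intro!: Sup_least simp: nat_le_iff)
qed

lemma consecutive_occurrence_exists:
  assumes "occurs_at B w i" "occurs_at B w j" "i < j"
  shows "\<exists>k. consecutive_occurrences B w i k"
proof -
  define P where "P n \<longleftrightarrow> n > 0 \<and> occurs_at B w (i + int n)" for n :: nat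
  have "P (nat (j - i))"
    using assms by (simp add: P_def)
  then have least: "P (Least P)"
    by (rule LeastI)
  have "\<not> occurs_at B w k" if "i < k" "k < i + int (Least P)" for k
  proof
    assume "occurs_at B w k"
    then have "P (nat (k - i))" using that by (simp add: P_def)
    then have "Least P \<le> nat (k - i)" by (rule Least_le)
    with that show False by linarith
  qed
  then have "consecutive_occurrences B w i (i + int (Least P))"
    using least assms unfolding consecutive_occurrences_def P_def by auto
  then show ?thesis ..
qed

text \<open>A finite bound excludes unique occurrences, so the window at \<open>i\<close> occurs
  again. The second occurrence may lie to the left of \<open>i\<close>, so the consecutive pair need
  not start at \<open>i\<close>.\<close>

lemma recurrence_function_leD:
  assumes "recurrence_function B T \<le> enat N" and "\<And>k. B k \<in> {0, 1}"
  obtains j d where "0 < d" "d \<le> int N"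
    "\<And>m. m < T \<Longrightarrow> B (j + int m) = B (i + int m)"
    "\<And>m. m < T \<Longrightarrow> B (j + d + int m) = B (i + int m)"
proof -
  define w where "w = map (\<lambda>m. B (i + int m)) [0..<T]"
  have w: "set w \<subseteq> {0, 1}" "length w = T" "occurs_at B w i"
    using assms(2) by (auto simp: w_def occurs_at_def)
  have not_unique: "\<not> (\<exists>w. set w \<subseteq> {0, 1} \<and> length w = T \<and> (\<exists>!i. occurs_at B w i))"
    using assms(1) unfolding recurrence_function_def by (auto split: if_splits)
  then have "\<not> (\<exists>!i. occurs_at B w i)"
    using w by simp
  then obtain i' where "occurs_at B w i'" "i' \<noteq> i"
    using w(3) by blast
  then obtain j k where jk: "consecutive_occurrences B w j k"
    using consecutive_occurrence_exists w(3) by (metis linorder_neqE)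
  have "enat (nat (k - j)) \<le> recurrence_function B T"
    unfolding recurrence_function_def if_not_P[OF not_unique]
    by (rule Sup_upper) (use w(1,2) jk in blast)
  with assms(1) have "enat (nat (k - j)) \<le> enat N"
    by (rule order_trans[rotated])
  then have "k - j \<le> int N"
    by simp
  moreover have "j < k" "occurs_at B w j" "occurs_at B w k"
    using jk unfolding consecutive_occurrences_def by auto
  ultimately show ?thesis
    by (intro that[of "k - j" j]) (auto simp: occurs_at_def w_def)
qed

section \<open>Beatty words as codings of a rotation\<close>

lemma sum_beatty:
  "(\<Sum>m<T. beatty \<alpha> (i + int m)) = \<lfloor>of_int (i + int T) * \<alpha>\<rfloor> - \<lfloor>of_int i * \<alpha>\<rfloor>"
  by (induction T) (auto simp: beatty_def add_ac)

lemma recurrence_beatty_rational: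
  assumes "0 < q" "real q * \<alpha> = of_int p"
  shows "recurrence_function (beatty \<alpha>) T \<le> enat q"
proof (rule recurrence_function_le)
  fix i
  have "\<lfloor>of_int (k + int q) * \<alpha>\<rfloor> = \<lfloor>of_int k * \<alpha>\<rfloor> + p" for k
  proof -
    have "of_int (k + int q) * \<alpha> = of_int k * \<alpha> + of_int p"
      using assms(2) by (simp add: algebra_simps)
    then show ?thesis by simp
  qed
  from this[of "_ + 1"] this have "beatty \<alpha> (k + int q) = beatty \<alpha> k" for k
    by (simp add: beatty_def add_ac)
  from this[of "i + int m" for m]
  have "\<forall>m<T. beatty \<alpha> (i + int q + int m) = beatty \<alpha> (i + int m)"
    by (simp add: add_ac)
  with \<open>0 < q\<close> show "\<exists>j>i. j \<le> i + int q \<and> (\<forall>m<T. beatty \<alpha> (j + int m) = beatty \<alpha> (i + int m))"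
    by (intro exI[of _ "i + int q"]) auto
qed

text \<open>Equal words have equal sums. By \<open>sum_beatty\<close> a prescribed sum other than
  \<open>p\<close> confines the fractional parts at \<open>j\<close> and \<open>j + d\<close> to one
  arc of length \<bar>\<delta>\<bar>.\<close>

lemma recurrence_beatty_lower:
  assumes "\<alpha> \<in> {0..1}" "recurrence_function (beatty \<alpha>) q \<le> enat N"
    and "real q * \<alpha> - of_int p \<noteq> 0" "\<bar>real q * \<alpha> - of_int p\<bar> < 1"
  obtains d e where "0 < d" "d \<le> int N"
    "\<bar>of_int d * \<alpha> - of_int e\<bar> < \<bar>real q * \<alpha> - of_int p\<bar>"
proof -
  define \<delta> where "\<delta> = real q * \<alpha> - of_int p"
  \<comment> \<open>The windows at \<open>- int q\<close> and 0 have sums \<lceil>q\<alpha>\<rceil>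
    and \<lfloor>q\<alpha>\<rfloor>. The sign of \<delta> selects the one that differs from
    \<open>p\<close>: the sum is \<open>p + 1\<close> or \<open>p - 1\<close>.\<close>
  define i where "i = (if \<delta> > 0 then - int q else 0)"
  obtain j d where d: "0 < d" "d \<le> int N"
    and eq: "\<And>m. m < q \<Longrightarrow> beatty \<alpha> (j + int m) = beatty \<alpha> (i + int m)"
      "\<And>m. m < q \<Longrightarrow> beatty \<alpha> (j + d + int m) = beatty \<alpha> (i + int m)"
    using recurrence_function_leD[OF assms(2) beatty_in_01[OF assms(1)], of i] by metis
  define s where "s = (\<Sum>m<q. beatty \<alpha> (i + int m))"
  have "(\<Sum>m<q. beatty \<alpha> (j + int m)) = s" "(\<Sum>m<q. beatty \<alpha> (j + d + int m)) = s"
    unfolding s_def using eq by simp_all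
  then have occ: "\<lfloor>of_int k * \<alpha> + \<delta>\<rfloor> + p - \<lfloor>of_int k * \<alpha>\<rfloor> = s" if "k \<in> {j, j + d}" for k
  proof -
    have "of_int (k + int q) * \<alpha> = (of_int k * \<alpha> + \<delta>) + of_int p"
      by (simp add: \<delta>_def algebra_simps)
    then have "\<lfloor>of_int (k + int q) * \<alpha>\<rfloor> = \<lfloor>of_int k * \<alpha> + \<delta>\<rfloor> + p"
      by simp
    with that \<open>(\<Sum>m<q. beatty \<alpha> (j + int m)) = s\<close> \<open>(\<Sum>m<q. beatty \<alpha> (j + d + int m)) = s\<close>
    show ?thesis
      unfolding sum_beatty by auto
  qed
  have \<delta>: "\<delta> \<noteq> 0" "\<bar>\<delta>\<bar> < 1"
    using assms by (auto simp: \<delta>_def)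
  \<comment> \<open>With this integer, d\<alpha> - f is exactly the difference of the two fractional
    parts.\<close>
  define f where "f = \<lfloor>of_int (j + d) * \<alpha>\<rfloor> - \<lfloor>of_int j * \<alpha>\<rfloor>"
  have "\<bar>of_int d * \<alpha> - of_int f\<bar> < \<bar>\<delta>\<bar>"
  proof (cases "\<delta> > 0")
    case True
    have "real q * \<alpha> = of_int p + \<delta>"
      by (simp add: \<delta>_def)
    then have "\<lfloor>- (real q * \<alpha>)\<rfloor> = - p - 1"
      using True \<delta> by (intro floor_unique) auto
    then have "s = p + 1"
      unfolding s_def sum_beatty using True by (simp add: i_def)
    then have "\<lfloor>of_int k * \<alpha> + \<delta>\<rfloor> = \<lfloor>of_int k * \<alpha>\<rfloor> + 1" if "k \<in> {j, j + d}" for k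
      using occ[OF that] by simp
    then have "frac (of_int k * \<alpha>) \<ge> 1 - \<delta>" if "k \<in> {j, j + d}" for k
      using that of_int_floor_le[of "of_int k * \<alpha> + \<delta>"] unfolding frac_def by fastforce
    then have "frac (of_int j * \<alpha>) \<ge> 1 - \<delta>" "frac (of_int (j + d) * \<alpha>) \<ge> 1 - \<delta>"
      by blast+
    then have "\<bar>frac (of_int (j + d) * \<alpha>) - frac (of_int j * \<alpha>)\<bar> < \<bar>\<delta>\<bar>"
      using frac_lt_1[of "of_int (j + d) * \<alpha>"] frac_lt_1[of "of_int j * \<alpha>"] by linarith
    then show ?thesis
      by (simp add: f_def frac_def algebra_simps)
  next
    case False
    have "real q * \<alpha> = of_int p + \<delta>"
      by (simp add: \<delta>_def)
    then have "\<lfloor>real q * \<alpha>\<rfloor> = p - 1"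
      using False \<delta> by (intro floor_unique) auto
    then have "s = p - 1"
      unfolding s_def sum_beatty using False by (simp add: i_def)
    then have "\<lfloor>of_int k * \<alpha> + \<delta>\<rfloor> = \<lfloor>of_int k * \<alpha>\<rfloor> - 1" if "k \<in> {j, j + d}" for k
      using occ[OF that] by simp
    then have "frac (of_int k * \<alpha>) < - \<delta>" if "k \<in> {j, j + d}" for k
      using that floor_correct[of "of_int k * \<alpha> + \<delta>"] unfolding frac_def by fastforce
    then have "frac (of_int j * \<alpha>) < - \<delta>" "frac (of_int (j + d) * \<alpha>) < - \<delta>"
      by blast+
    then have "\<bar>frac (of_int (j + d) * \<alpha>) - frac (of_int j * \<alpha>)\<bar> < \<bar>\<delta>\<bar>"
      using frac_ge_0[of "of_int (j + d) * \<alpha>"] frac_ge_0[of "of_int j * \<alpha>"] by linarith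
    then show ?thesis
      by (simp add: f_def frac_def algebra_simps)
  qed
  with d show ?thesis
    by (intro that[of d f]) (simp_all add: \<delta>_def)
qed

text \<open>\<open>T\<close> letters involve \<open>T + 1\<close> floors, hence the range
  \<open>m \<le> T\<close>. The shift adds the same \<open>e\<close> to each floor, which cancels in
  the differences.\<close>

lemma beatty_shift:
  assumes "\<And>m. m \<le> T \<Longrightarrow> \<lfloor>of_int (i + int m) * \<alpha> + (of_int d * \<alpha> - of_int e)\<rfloor> = \<lfloor>of_int (i + int m) * \<alpha>\<rfloor>"
    and "m < T"
  shows "beatty \<alpha> (i + d + int m) = beatty \<alpha> (i + int m)"
proof -
  have "\<lfloor>of_int (i + d + int n) * \<alpha>\<rfloor> = \<lfloor>of_int (i + int n) * \<alpha>\<rfloor> + e" if "n \<le> T" for n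
  proof -
    have "of_int (i + d + int n) * \<alpha>
        = (of_int (i + int n) * \<alpha> + (of_int d * \<alpha> - of_int e)) + of_int e"
      by (simp add: algebra_simps)
    then show ?thesis
      using assms(1)[OF that] by (metis floor_add_int)
  qed
  from this[of m] this[of "Suc m"] \<open>m < T\<close> show ?thesis
    by (simp add: beatty_def add_ac)
qed

text \<open>The forward shift fails only if some point x of the window is at most
  \<open>\<delta>\<^sub>1\<close> below the next integer, the backward one only if some y is less
  than \<open>\<delta>\<^sub>2\<close> above an integer. If both fail, y - x is too close to an
  integer for \<open>far\<close>.\<close>

lemma recurrence_beatty_upper:
  assumes d: "0 < d\<^sub>1" "d\<^sub>1 \<le> int N" "0 < d\<^sub>2" "d\<^sub>2 \<le> int N"
    and th1: "of_int d\<^sub>1 * \<alpha> - of_int e\<^sub>1 = \<delta>\<^sub>1" "0 < \<delta>\<^sub>1"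
    and th2: "of_int d\<^sub>2 * \<alpha> - of_int e\<^sub>2 = - \<delta>\<^sub>2" "0 < \<delta>\<^sub>2"
    and le1: "\<delta>\<^sub>1 + \<delta>\<^sub>2 \<le> 1"
    and far: "\<And>m e. 0 < m \<Longrightarrow> m \<le> int T \<Longrightarrow> \<bar>of_int m * \<alpha> - of_int e\<bar> \<ge> \<delta>\<^sub>1 + \<delta>\<^sub>2"
  shows "recurrence_function (beatty \<alpha>) T \<le> enat N"
proof (rule recurrence_function_le)
  fix i
  consider (up) "\<And>m. m \<le> T \<Longrightarrow> \<lfloor>of_int (i + int m) * \<alpha> + \<delta>\<^sub>1\<rfloor> = \<lfloor>of_int (i + int m) * \<alpha>\<rfloor>"
    | (down) "\<And>m. m \<le> T \<Longrightarrow> \<lfloor>of_int (i + int m) * \<alpha> + - \<delta>\<^sub>2\<rfloor> = \<lfloor>of_int (i + int m) * \<alpha>\<rfloor>"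
    | (none) m n where "m \<le> T" "n \<le> T"
      "\<lfloor>of_int (i + int m) * \<alpha> + \<delta>\<^sub>1\<rfloor> \<noteq> \<lfloor>of_int (i + int m) * \<alpha>\<rfloor>"
      "\<lfloor>of_int (i + int n) * \<alpha> + - \<delta>\<^sub>2\<rfloor> \<noteq> \<lfloor>of_int (i + int n) * \<alpha>\<rfloor>"
    by blast
  then show "\<exists>j>i. j \<le> i + int N \<and> (\<forall>m<T. beatty \<alpha> (j + int m) = beatty \<alpha> (i + int m))"
  proof cases
    case up
    with d th1 show ?thesis
      by (intro exI[of _ "i + d\<^sub>1"] conjI allI impI beatty_shift[of T i \<alpha> d\<^sub>1 e\<^sub>1]) auto
  next
    case down
    with d th2 show ?thesis
      by (intro exI[of _ "i + d\<^sub>2"] conjI allI impI beatty_shift[of T i \<alpha> d\<^sub>2 e\<^sub>2]) auto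
  next
    case none
    define x where "x = of_int (i + int m) * \<alpha>"
    define y where "y = of_int (i + int n) * \<alpha>"
    have "x + \<delta>\<^sub>1 \<ge> of_int \<lfloor>x\<rfloor> + 1"
    proof (rule ccontr)
      assume "\<not> ?thesis"
      then have "\<lfloor>x + \<delta>\<^sub>1\<rfloor> = \<lfloor>x\<rfloor>"
        using \<open>0 < \<delta>\<^sub>1\<close> by (intro floor_unique) linarith+
      with none show False by (simp add: x_def)
    qed
    moreover have "y - \<delta>\<^sub>2 < of_int \<lfloor>y\<rfloor>"
    proof (rule ccontr)
      assume "\<not> ?thesis"
      then have "\<lfloor>y + - \<delta>\<^sub>2\<rfloor> = \<lfloor>y\<rfloor>"
        using \<open>0 < \<delta>\<^sub>2\<close> by (intro floor_unique) linarith+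
      with none show False by (simp add: y_def)
    qed
    moreover define e where "e = \<lfloor>y\<rfloor> - \<lfloor>x\<rfloor> - 1"
    ultimately have e: "0 < y - x - of_int e" "y - x - of_int e < \<delta>\<^sub>1 + \<delta>\<^sub>2"
      by (simp_all, linarith+)
    have diff: "y - x = of_int (int n - int m) * \<alpha>"
      by (simp add: x_def y_def algebra_simps)
    consider "m = n" | "m < n" | "n < m" by linarith
    then have False
    proof cases
      \<comment> \<open>Here y = x, which \<open>far\<close> does not cover; \<open>le1\<close>
        leaves no room for the integer \<open>- e\<close>.\<close>
      case 1
      with e le1 diff have "0 < real_of_int (- e)" "real_of_int (- e) < 1"
        by auto
      then have "0 < - e" "- e < 1"
        by (simp_all only: of_int_0_less_iff of_int_less_1_iff)
      then show False by linarith
    next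
      case 2
      then have "\<bar>of_int (int n - int m) * \<alpha> - of_int e\<bar> \<ge> \<delta>\<^sub>1 + \<delta>\<^sub>2"
        using none by (intro far) auto
      with e diff show False by linarith
    next
      case 3
      then have "\<bar>of_int (int m - int n) * \<alpha> - of_int (- e)\<bar> \<ge> \<delta>\<^sub>1 + \<delta>\<^sub>2"
        using none by (intro far) auto
      moreover have "of_int (int m - int n) * \<alpha> - of_int (- e) = - (y - x - of_int e)"
        using diff by (simp add: algebra_simps)
      ultimately show False using e by linarith
    qed
    then show ?thesis ..
  qed
qed

section \<open>Continued fractions\<close>

text \<open>This is the Euclidean algorithm: a/b becomes b/(a mod b), and the positive denominators
  strictly decrease.\<close>

lemma complete_quotient_rational:
  assumes "0 < q" "x = of_int p / of_int q" "complete_quotient x n = Some y"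
  shows "\<exists>a b. 0 < b \<and> b + int n \<le> q \<and> y = of_int a / of_int b"
  using assms(3)
proof (induction n arbitrary: y)
  case 0
  with assms show ?case by auto
next
  case (Suc n)
  then obtain z where z: "complete_quotient x n = Some z" "frac z \<noteq> 0" "y = 1 / frac z"
    by (auto split: option.splits if_splits)
  then obtain a b where ab: "0 < b" "b + int n \<le> q" "z = of_int a / of_int b"
    using Suc.IH by blast
  have "frac z = of_int (a mod b) / of_int b"
  proof -
    have "real_of_int a = of_int b * of_int (a div b) + of_int (a mod b)"
      by (metis mult_div_mod_eq of_int_add of_int_mult)
    then show ?thesis
      using ab(1) unfolding frac_def ab(3) floor_divide_of_int_eq by (simp add: field_simps)
  qed
  with z have y: "y = of_int b / of_int (a mod b)" and "a mod b \<noteq> 0"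
    by auto
  moreover have "0 \<le> a mod b" "a mod b < b"
    using ab by auto
  ultimately have "0 < a mod b \<and> a mod b + int (Suc n) \<le> q"
    using ab(2) by linarith
  with y show ?case by blast
qed

lemma badly_approximable_rational:
  assumes "x \<in> \<rat>"
  shows "badly_approximable x"
proof -
  obtain p q where pq: "0 < q" "x = of_int p / of_int q"
    using assms by (elim Rats_cases') auto
  \<comment> \<open>Past the end of the expansion, \<open>the None\<close> only adds an unspecified
    integer to a finite maximum.\<close>
  define C where "C = Max ((\<lambda>n. \<bar>the (partial_quotient x n)\<bar>) ` {..nat q})"
  have "\<bar>a\<bar> \<le> C" if a: "partial_quotient x n = Some a" for n a
  proof -
    obtain y where "complete_quotient x n = Some y"
      using a by (auto simp: partial_quotient_def)
    then have "n \<le> nat q"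
      using complete_quotient_rational[OF pq] by fastforce
    then have "\<bar>the (partial_quotient x n)\<bar> \<le> C"
      unfolding C_def by (intro Max_ge) auto
    with a show ?thesis by simp
  qed
  then show ?thesis
    unfolding badly_approximable_def by blast
qed

text \<open>The indices of the convergents are shifted by one: \<open>num (n + 1) / den (n + 1)\<close> is the usual
  \<open>p\<^sub>n / q\<^sub>n\<close>, and \<open>num 0 = p\<^sub>-\<^sub>1 = 1\<close>, \<open>den 0 = q\<^sub>-\<^sub>1 = 0\<close>.\<close>

locale irrational =
  fixes \<alpha> :: real
  assumes irrational: "\<alpha> \<notin> \<rat>"
begin

text \<open>Version of \<open>complete_quotient\<close> without options: for irrational \<alpha> the
  expansion never stops.\<close>

primrec cq :: "nat \<Rightarrow> real" where
  "cq 0 = \<alpha>"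
| "cq (Suc n) = 1 / frac (cq n)"

abbreviation pq :: "nat \<Rightarrow> int" where
  "pq n \<equiv> \<lfloor>cq n\<rfloor>"

fun num :: "nat \<Rightarrow> int" where
  "num 0 = 1"
| "num (Suc 0) = pq 0"
| "num (Suc (Suc n)) = pq (Suc n) * num (Suc n) + num n"

fun den :: "nat \<Rightarrow> int" where
  "den 0 = 0"
| "den (Suc 0) = 1"
| "den (Suc (Suc n)) = pq (Suc n) * den (Suc n) + den n"

definition err :: "nat \<Rightarrow> real" where
  "err n = of_int (den n) * \<alpha> - of_int (num n)"

lemma cq_irrational: "cq n \<notin> \<rat>"
proof (induction n)
  case 0
  show ?case by (simp add: irrational)
next
  case (Suc n)
  show ?case
  proof
    assume "cq (Suc n) \<in> \<rat>"
    then have "of_int \<lfloor>cq n\<rfloor> + inverse (cq (Suc n)) \<in> \<rat>"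
      by (intro Rats_add Rats_inverse Rats_of_int)
    then show False
      using Suc by (simp add: frac_def)
  qed
qed

lemma frac_cq_pos: "0 < frac (cq n)"
  using cq_irrational[of n] by (metis Ints_subset_Rats frac_gt_0_iff subsetD)

lemma complete_quotient_eq: "complete_quotient \<alpha> n = Some (cq n)"
proof (induction n)
  case (Suc n)
  then show ?case using frac_cq_pos[of n] by simp
qed simp

lemma badly_approximable_iff: "badly_approximable \<alpha> \<longleftrightarrow> (\<exists>C. \<forall>n. \<bar>pq n\<bar> \<le> C)"
  by (simp add: badly_approximable_def partial_quotient_def complete_quotient_eq)

lemma cq_Suc_gt_1: "1 < cq (Suc n)"
  using frac_cq_pos[of n] frac_lt_1[of "cq n"] by simp

lemma pq_Suc_ge_1: "1 \<le> pq (Suc n)"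
  using cq_Suc_gt_1[of n] by linarith

section \<open>Alternation and decay of the errors of the convergents\<close>

lemma err_0: "err 0 = -1" and err_Suc_0: "err (Suc 0) = frac \<alpha>"
  by (simp_all add: err_def frac_def)

lemma err_rec: "err (Suc (Suc n)) = of_int (pq (Suc n)) * err (Suc n) + err n"
  by (simp add: err_def algebra_simps)

text \<open>Inductively, the recurrence becomes multiplication by
  \<open>- frac (cq (Suc n))\<close>, the reciprocal of \<open>- cq (Suc (Suc n))\<close>.\<close>

lemma err_cq: "err n = - cq (Suc n) * err (Suc n)"
proof (induction n)
  case 0
  then show ?case using frac_cq_pos[of 0] by (simp add: err_0 err_Suc_0)
next
  case (Suc n)
  have "err (Suc (Suc n)) = - frac (cq (Suc n)) * err (Suc n)"
    using Suc by (subst err_rec) (simp add: frac_def algebra_simps)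
  then show ?case
    using frac_cq_pos[of "Suc n"] by simp
qed

lemma err_opposite: "err n * err (Suc n) < 0"
proof (induction n)
  case 0
  then show ?case using frac_cq_pos[of 0] by (simp add: err_0 err_Suc_0)
next
  case (Suc n)
  then have "err (Suc n) \<noteq> 0" by auto
  then have "err (Suc (Suc n)) \<noteq> 0"
    using err_cq[of "Suc n"] by auto
  then have "0 < cq (Suc (Suc n)) * (err (Suc (Suc n)))\<^sup>2"
    using cq_Suc_gt_1[of "Suc n"] by (simp del: cq.simps)
  moreover have "err (Suc n) * err (Suc (Suc n)) = - (cq (Suc (Suc n)) * (err (Suc (Suc n)))\<^sup>2)"
    using err_cq[of "Suc n"] by (simp add: power2_eq_square del: cq.simps)
  ultimately show ?case by linarith
qed

lemma err_nonzero: "err n \<noteq> 0"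
  using err_opposite[of n] by auto

text \<open>By alternation \<open>err n\<close> and \<open>err (Suc (Suc n))\<close> share a sign,
  opposite to that of \<open>err (Suc n)\<close>, so solving the recurrence for \<open>err n\<close>
  involves no cancellation.\<close>

lemma abs_err_rec: "\<bar>err n\<bar> = of_int (pq (Suc n)) * \<bar>err (Suc n)\<bar> + \<bar>err (Suc (Suc n))\<bar>"
proof -
  have "1 \<le> real_of_int (pq (Suc n))"
    using pq_Suc_ge_1[of n] by linarith
  then show ?thesis
    using err_rec[of n] err_opposite[of n] err_opposite[of "Suc n"]
    by (auto simp: mult_less_0_iff)
qed

lemma abs_err_add_le: "\<bar>err (Suc n)\<bar> + \<bar>err (Suc (Suc n))\<bar> \<le> \<bar>err n\<bar>"
proof -
  have "1 * \<bar>err (Suc n)\<bar> \<le> of_int (pq (Suc n)) * \<bar>err (Suc n)\<bar>"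
    using pq_Suc_ge_1[of n] by (intro mult_right_mono) auto
  then show ?thesis
    unfolding abs_err_rec[of n] by simp
qed

lemma abs_err_le_1: "\<bar>err n\<bar> \<le> 1"
proof (induction n)
  case (Suc n)
  then show ?case using abs_err_add_le[of n] by linarith
qed (simp add: err_0)

lemma abs_err_Suc_less_1: "\<bar>err (Suc n)\<bar> < 1"
  using abs_err_add_le[of n] abs_err_le_1[of n] err_nonzero[of "Suc (Suc n)"] by linarith

section \<open>Growth of the denominators and best approximation\<close>

lemma den_nonneg: "0 \<le> den n"
proof (induction n rule: den.induct)
  case (3 n)
  then show ?case using pq_Suc_ge_1[of n] by simp
qed auto

lemma den_rec_ge: "den (Suc n) + den n \<le> den (Suc (Suc n))"
proof -
  have "1 * den (Suc n) \<le> pq (Suc n) * den (Suc n)"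
    using pq_Suc_ge_1[of n] den_nonneg by (intro mult_right_mono) auto
  then show ?thesis by simp
qed

lemma den_Suc_pos: "0 < den (Suc n)"
proof (induction n)
  case (Suc n)
  then show ?case using den_rec_ge[of n] den_nonneg[of n] by linarith
qed simp

lemma den_le_Suc: "den n \<le> den (Suc n)"
proof (cases n)
  case (Suc m)
  then show ?thesis using den_rec_ge[of m] den_nonneg[of m] by (simp del: den.simps)
qed simp

text \<open>\<open>den 1\<close> and \<open>den 2\<close> may both be 1; strict growth starts only
  afterwards, hence the bound \<open>int n\<close>.\<close>

lemma den_Suc_ge: "int n \<le> den (Suc n)"
proof (induction n)
  case (Suc n)
  show ?case
  proof (cases n)
    case (Suc m)
    then show ?thesis
      using Suc.IH den_rec_ge[of n] den_Suc_pos[of m] by (simp del: den.simps)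
  qed (use den_Suc_pos[of 1] in simp)
qed simp

lemma num_den_det: "\<bar>num (Suc n) * den n - num n * den (Suc n)\<bar> = 1"
proof (induction n)
  case (Suc n)
  have "num (Suc (Suc n)) * den (Suc n) - num (Suc n) * den (Suc (Suc n))
      = - (num (Suc n) * den n - num n * den (Suc n))"
    by (simp add: algebra_simps)
  then show ?case using Suc by simp
qed simp

text \<open>The pair \<open>(d, e)\<close> is an integral combination of two consecutive convergents; the bound on \<open>d\<close>
  forces coefficients of opposite signs, so that the errors do not cancel.\<close>

lemma best_approximation:
  assumes "0 < d" "d < den (Suc n)"
  shows "\<bar>err n\<bar> \<le> \<bar>of_int d * \<alpha> - of_int e\<bar>"
proof -
  define D where "D = num (Suc n) * den n - num n * den (Suc n)"
  have DD: "D * D = 1"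
    using num_den_det[of n] unfolding D_def[symmetric] by (metis abs_mult_self_eq mult_1)
  \<comment> \<open>Cramer's rule; the determinant \<open>D\<close> is 1 or -1 and hence its own
    inverse, so \<open>u\<close> and \<open>v\<close> are integers.\<close>
  define u where "u = D * (d * num (Suc n) - e * den (Suc n))"
  define v where "v = D * (e * den n - d * num n)"
  have "u * den n + v * den (Suc n) = D * D * d" "u * num n + v * num (Suc n) = D * D * e"
    by (simp_all add: u_def v_def D_def algebra_simps)
  then have d: "d = u * den n + v * den (Suc n)" and e: "e = u * num n + v * num (Suc n)"
    using DD by simp_all
  have split: "of_int d * \<alpha> - of_int e = of_int u * err n + of_int v * err (Suc n)"
    by (simp add: d e err_def algebra_simps)
  have pos: "0 < den (Suc n)" "0 \<le> den n"
    by (rule den_Suc_pos, rule den_nonneg)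
  have "u \<noteq> 0"
  proof
    assume "u = 0"
    then have "0 < v * den (Suc n)" "v * den (Suc n) < 1 * den (Suc n)"
      using assms d by auto
    then show False
      using pos by (simp add: zero_less_mult_iff mult_less_cancel_right)
  qed
  then have u1: "1 \<le> \<bar>real_of_int u\<bar>"
    by linarith
  have "u * v \<le> 0"
  proof (rule ccontr)
    assume "\<not> ?thesis"
    then consider "0 < u" "0 < v" | "u < 0" "v < 0"
      by (auto simp: not_le zero_less_mult_iff)
    then show False
    proof cases
      case 1
      then have "0 \<le> u * den n" "1 * den (Suc n) \<le> v * den (Suc n)"
        using pos by (auto intro!: mult_right_mono simp del: mult_1)
      with d assms show False by linarith
    next
      case 2
      then have "u * den n \<le> 0" "v * den (Suc n) \<le> 0"
        using pos by (auto simp: mult_le_0_iff)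
      with d assms show False by linarith
    qed
  qed
  then have uv: "real_of_int u * of_int v \<le> 0"
    by (metis of_int_le_0_iff of_int_mult)
  have "(of_int u * err n) * (of_int v * err (Suc n)) = (of_int u * of_int v) * (err n * err (Suc n))"
    by simp
  also have "\<dots> \<ge> 0"
    using uv err_opposite[of n] by (intro mult_nonpos_nonpos) auto
  finally have "0 \<le> (of_int u * err n) * (of_int v * err (Suc n))" .
  then have "\<bar>of_int u * err n\<bar> \<le> \<bar>of_int u * err n + of_int v * err (Suc n)\<bar>"
    by (auto simp: zero_le_mult_iff)
  moreover have "1 * \<bar>err n\<bar> \<le> \<bar>of_int u\<bar> * \<bar>err n\<bar>"
    using u1 by (intro mult_right_mono) auto
  ultimately show ?thesis
    unfolding split by (simp add: abs_mult)
qed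

section \<open>The recurrence function between convergent denominators\<close>

lemma recurrence_den_lower:
  assumes "\<alpha> \<in> {0..1}" "recurrence_function (beatty \<alpha>) (nat (den (Suc n))) \<le> enat N"
  shows "den (Suc (Suc n)) \<le> int N"
proof -
  have err: "real (nat (den (Suc n))) * \<alpha> - of_int (num (Suc n)) = err (Suc n)"
    using den_nonneg[of "Suc n"] by (simp add: err_def)
  obtain d e where "0 < d" "d \<le> int N" "\<bar>of_int d * \<alpha> - of_int e\<bar> < \<bar>err (Suc n)\<bar>"
    using recurrence_beatty_lower[OF assms, of "num (Suc n)"]
      err_nonzero[of "Suc n"] abs_err_Suc_less_1[of n] unfolding err by blast
  then show ?thesis
    using best_approximation[of d "Suc n" e] by linarith
qed

text \<open>Up to \<open>T\<close> all errors are at least \<bar>\<open>err n\<close>\<bar>, which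
  dominates the sum of the next two. Their denominators serve as the two shifts; the signs decide
  which one goes forward.\<close>

lemma recurrence_den_upper:
  assumes "int T < den (Suc n)"
  shows "recurrence_function (beatty \<alpha>) T \<le> enat (nat (den (Suc (Suc n))))"
proof -
  have far: "\<bar>err (Suc n)\<bar> + \<bar>err (Suc (Suc n))\<bar> \<le> \<bar>of_int m * \<alpha> - of_int e\<bar>"
    if "0 < m" "m \<le> int T" for m e
    using best_approximation[of m n e] abs_err_add_le[of n] that assms by linarith
  have le1: "\<bar>err (Suc n)\<bar> + \<bar>err (Suc (Suc n))\<bar> \<le> 1"
    using abs_err_add_le[of n] abs_err_le_1[of n] by linarith
  have den: "0 < den (Suc n)" "den (Suc n) \<le> int (nat (den (Suc (Suc n))))"
    "0 < den (Suc (Suc n))" "den (Suc (Suc n)) \<le> int (nat (den (Suc (Suc n))))"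
    using den_Suc_pos[of n] den_le_Suc[of "Suc n"] by linarith+
  consider "0 < err (Suc n)" "err (Suc (Suc n)) < 0" | "err (Suc n) < 0" "0 < err (Suc (Suc n))"
    using err_opposite[of "Suc n"] by (auto simp: mult_less_0_iff)
  then show ?thesis
  proof cases
    case 1
    show ?thesis
      by (rule recurrence_beatty_upper[of "den (Suc n)" _ "den (Suc (Suc n))" _ "num (Suc n)"
            "\<bar>err (Suc n)\<bar>" "num (Suc (Suc n))" "\<bar>err (Suc (Suc n))\<bar>"])
        (use den far le1 1 in \<open>simp_all add: err_def del: num.simps den.simps\<close>)
  next
    case 2
    show ?thesis
      by (rule recurrence_beatty_upper[of "den (Suc (Suc n))" _ "den (Suc n)" _ "num (Suc (Suc n))"
            "\<bar>err (Suc (Suc n))\<bar>" "num (Suc n)" "\<bar>err (Suc n)\<bar>"])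
        (use den far le1 2 in \<open>simp_all add: err_def add.commute del: num.simps den.simps\<close>)
  qed
qed

lemma recurrence_unbounded:
  assumes "\<alpha> \<in> {0..1}"
  shows "\<not> (\<exists>C::nat. \<forall>T\<ge>1. recurrence_function (beatty \<alpha>) T \<le> enat C)"
proof
  assume "\<exists>C::nat. \<forall>T\<ge>1. recurrence_function (beatty \<alpha>) T \<le> enat C"
  then obtain C :: nat where C: "\<And>T. T \<ge> 1 \<Longrightarrow> recurrence_function (beatty \<alpha>) T \<le> enat C"
    by blast
  have "recurrence_function (beatty \<alpha>) (nat (den (Suc C))) \<le> enat C"
    using den_Suc_pos[of C] by (intro C) linarith
  then have "den (Suc (Suc C)) \<le> int C"
    by (rule recurrence_den_lower[OF assms])
  then show False
    using den_Suc_ge[of "Suc C"] by linarith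
qed

text \<open>At length \<open>den (Suc n)\<close> the lower bound \<open>den (Suc (Suc n))\<close>
  contains the summand \<open>pq (Suc n) * den (Suc n)\<close>; dividing by the length bounds the
  partial quotient.\<close>

lemma badly_approximable_if_linear_recurrence:
  assumes "\<alpha> \<in> {0..1}"
    and "\<forall>\<^sub>F T in sequentially.
           ereal_of_enat (recurrence_function (beatty \<alpha>) T) \<le> ereal (C * real T)"
  shows "badly_approximable \<alpha>"
proof -
  obtain T0 where T0: "\<And>T. T \<ge> T0 \<Longrightarrow>
      ereal_of_enat (recurrence_function (beatty \<alpha>) T) \<le> ereal (C * real T)"
    using assms(2) by (auto simp: eventually_sequentially)
  have large: "real_of_int (pq (Suc n)) \<le> C" if "n \<ge> T0" for n
  proof -
    define T where "T = nat (den (Suc n))"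
    have T: "int T = den (Suc n)" "0 < T"
      using den_Suc_pos[of n] by (auto simp: T_def)
    have "T0 \<le> T"
      using that den_Suc_ge[of n] T by linarith
    then have bound: "ereal_of_enat (recurrence_function (beatty \<alpha>) T) \<le> ereal (C * real T)"
      by (rule T0)
    then obtain N where N: "recurrence_function (beatty \<alpha>) T = enat N"
      by (cases "recurrence_function (beatty \<alpha>) T") auto
    then have "den (Suc (Suc n)) \<le> int N"
      by (intro recurrence_den_lower assms(1)) (simp add: T_def)
    then have "pq (Suc n) * int T \<le> int N"
      using den_nonneg[of n] T by simp
    then have "real_of_int (pq (Suc n)) * real T \<le> real N"
      by (metis of_int_le_iff of_int_mult of_int_of_nat_eq)
    also have "\<dots> \<le> C * real T"
      using bound N by simp
    finally show ?thesis
      using T by simp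
  qed
  \<comment> \<open>\<open>large\<close> bounds only the indices above \<open>T0\<close>; the
    finitely many others enter through the maximum.\<close>
  define K where "K = max \<lfloor>C\<rfloor> (Max ((\<lambda>n. \<bar>pq n\<bar>) ` {..T0}))"
  have "\<bar>pq n\<bar> \<le> K" for n
  proof (cases "n \<le> T0")
    case True
    then have "\<bar>pq n\<bar> \<le> Max ((\<lambda>n. \<bar>pq n\<bar>) ` {..T0})"
      by (intro Max_ge) auto
    then show ?thesis by (simp add: K_def)
  next
    case False
    then obtain m where m: "n = Suc m" "m \<ge> T0"
      by (cases n) auto
    then have "pq n \<le> \<lfloor>C\<rfloor>"
      using large[of m] by (simp add: le_floor_iff del: cq.simps)
    moreover have "1 \<le> pq n"
      using pq_Suc_ge_1[of m] m by simp
    ultimately show ?thesis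
      by (simp add: K_def)
  qed
  then show ?thesis
    unfolding badly_approximable_iff by blast
qed

text \<open>Each denominator is at most \<open>K + 1\<close> times the previous one. The bound lies
  two denominators beyond the last one not exceeding \<open>T\<close>, hence the factor
  \<open>(K + 1)\<^sup>2\<close>.\<close>

lemma linear_recurrence_if_badly_approximable:
  assumes "badly_approximable \<alpha>"
  obtains C :: nat where "\<And>T. T \<ge> 1 \<Longrightarrow> recurrence_function (beatty \<alpha>) T \<le> enat (C * T)"
proof -
  obtain K where K: "\<And>n. \<bar>pq n\<bar> \<le> K"
    using assms badly_approximable_iff by blast
  then have "0 \<le> K"
    by (meson abs_ge_zero order_trans)
  have growth: "den (Suc (Suc n)) \<le> (K + 1) * den (Suc n)" for n
  proof -
    have "pq (Suc n) * den (Suc n) \<le> K * den (Suc n)"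
      using K[of "Suc n"] den_nonneg by (intro mult_right_mono) auto
    then show ?thesis
      using den_le_Suc[of n] by (simp add: algebra_simps)
  qed
  show ?thesis
  proof (rule that)
    fix T :: nat
    assume "T \<ge> 1"
    define P where "P n \<longleftrightarrow> int T < den (Suc n)" for n
    have "P (Suc T)"
      using den_Suc_ge[of "Suc T"] by (simp add: P_def del: den.simps)
    then have P: "P (Least P)"
      by (rule LeastI)
    \<comment> \<open>\<open>P 0\<close> fails because \<open>den (Suc 0) = 1 \<le> T\<close>, so
      the least index has a predecessor.\<close>
    then obtain n where n: "Least P = Suc n"
      using \<open>T \<ge> 1\<close> by (cases "Least P") (auto simp: P_def)
    then have "\<not> P n"
      by (metis lessI not_less_Least)
    then have T: "den (Suc n) \<le> int T"
      by (simp add: P_def)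
    have "den (Suc (Suc (Suc n))) \<le> (K + 1) * ((K + 1) * den (Suc n))"
      using growth[of "Suc n"] growth[of n] \<open>0 \<le> K\<close>
      by (meson mult_left_mono order_trans add_nonneg_nonneg zero_le_one)
    also have "\<dots> \<le> (K + 1) * ((K + 1) * int T)"
      using T \<open>0 \<le> K\<close> by (intro mult_left_mono) auto
    also have "\<dots> = int (nat ((K + 1)\<^sup>2) * T)"
      by (simp add: power2_eq_square)
    finally have "nat (den (Suc (Suc (Suc n)))) \<le> nat ((K + 1)\<^sup>2) * T"
      by linarith
    moreover have "recurrence_function (beatty \<alpha>) T \<le> enat (nat (den (Suc (Suc (Suc n)))))"
      using P unfolding n P_def by (rule recurrence_den_upper)
    ultimately show "recurrence_function (beatty \<alpha>) T \<le> enat (nat ((K + 1)\<^sup>2) * T)"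
      by (meson enat_ord_simps(1) order_trans)
  qed
qed

end

section \<open>Combination of the rational and irrational cases\<close>

lemma eventually_linear_recurrenceI:
  assumes "\<And>T. T \<ge> 1 \<Longrightarrow> recurrence_function B T \<le> enat (C * T)"
  shows "\<forall>\<^sub>F T in sequentially. ereal_of_enat (recurrence_function B T) \<le> ereal (real C * real T)"
proof (rule eventually_sequentiallyI)
  fix T :: nat
  assume "T \<ge> 1"
  then have "ereal_of_enat (recurrence_function B T) \<le> ereal_of_enat (enat (C * T))"
    using assms by (simp only: ereal_of_enat_le_iff)
  then show "ereal_of_enat (recurrence_function B T) \<le> ereal (real C * real T)"
    by simp
qed

theorem theorem8p2:
  fixes \<alpha> :: real
  assumes "\<alpha> \<in> {0..1}"
  shows "((\<exists>C::nat. \<forall>T\<ge>1. recurrence_function (beatty \<alpha>) T \<le> enat C) \<longleftrightarrow> \<alpha> \<in> \<rat>) \<and>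
         ((\<exists>C::real. \<forall>\<^sub>F T in sequentially.
             ereal_of_enat (recurrence_function (beatty \<alpha>) T) \<le> ereal (C * real T))
           \<longleftrightarrow> badly_approximable \<alpha>)"
proof (cases "\<alpha> \<in> \<rat>")
  case True
  then obtain p q where "0 < q" "\<alpha> = of_int p / of_int q"
    by (elim Rats_cases') auto
  then have q: "0 < nat q" "real (nat q) * \<alpha> = of_int p"
    by auto
  then have bound: "recurrence_function (beatty \<alpha>) T \<le> enat (nat q)" for T
    by (rule recurrence_beatty_rational)
  have "recurrence_function (beatty \<alpha>) T \<le> enat (nat q * T)" if "T \<ge> 1" for T
    using bound[of T] by (rule order_trans) (use that in simp)
  then have "\<forall>\<^sub>F T in sequentially.
      ereal_of_enat (recurrence_function (beatty \<alpha>) T) \<le> ereal (real (nat q) * real T)"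
    by (rule eventually_linear_recurrenceI)
  then show ?thesis
    using True bound badly_approximable_rational by blast
next
  case False
  then interpret irrational \<alpha>
    by unfold_locales
  show ?thesis
  proof (intro conjI iffI)
    assume "badly_approximable \<alpha>"
    then obtain C where "\<And>T. T \<ge> 1 \<Longrightarrow> recurrence_function (beatty \<alpha>) T \<le> enat (C * T)"
      using linear_recurrence_if_badly_approximable by blast
    then show "\<exists>C::real. \<forall>\<^sub>F T in sequentially.
        ereal_of_enat (recurrence_function (beatty \<alpha>) T) \<le> ereal (C * real T)"
      by (blast intro: eventually_linear_recurrenceI)
  \<comment> \<open>For irrational \<alpha> both sides of the first equivalence are false.\<close>
  qed (use False recurrence_unbounded[OF assms]
      badly_approximable_if_linear_recurrence[OF assms] in blast)+
qed

end
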